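(* Let $p\ge 0$, $q\ge 0$, $m\ge 0$ be integers and let $f,g,h$ be entire functions represented by vector valued Dirichlet series. Let $\rho_h^{(m,q)}(f)$, $\lambda_h^{(m,q)}(f)$ be the $(m,q)$-th relative Ritt order and relative Ritt lower order of $f$ with respect to $h$, and $\rho_h^{(m,p)}(g)$, $\lambda_h^{(m,p)}(g)$ the $(m,p)$-th relative Ritt order and relative Ritt lower order of $g$ with respect to $h$. Then $$\frac{\lambda_h^{(m,q)}(f)}{\rho_h^{(m,p)}(g)}\le \lambda_g^{(p,q)}(f)\le \min\left\{\frac{\lambda_h^{(m,q)}(f)}{\lambda_h^{(m,p)}(g)},\frac{\rho_h^{(m,q)}(f)}{\rho_h^{(m,p)}(g)}\right\}\le \max\left\{\frac{\lambda_h^{(m,q)}(f)}{\lambda_h^{(m,p)}(g)},\frac{\rho_h^{(m,q)}(f)}{\rho_h^{(m,p)}(g)}\right\}\le \rho_g^{(p,q)}(f)\le \frac{\rho_h^{(m,q)}(f)}{\lambda_h^{(m,p)}(g)}.$$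
   Context: VVDS: an entire function represented by a vector valued Dirichlet series is a function $f(s)=\sum_{n\ge1}a_ne^{s\lambda_n}$, $s=\sigma+it$, not identically zero, with $a_n$ in a complex Banach space $(E,\|\cdot\|)$, $0<\lambda_n<\lambda_{n+1}$, $\lambda_n\to+\infty$, $\limsup_{n}\frac{\log n}{\lambda_n}<+\infty$ and $\limsup_{n}\frac{\log\|a_n\|}{\lambda_n}=-\infty$ (so the series converges absolutely everywhere). Its maximum modulus is $M_f(\sigma)=\sup_{t\in\mathbb R}\|f(\sigma+it)\|$, and $M_f^{-1}$ is the inverse function of $M_f$. Iterated logarithms: $\log^{[0]}x=x$, $\log^{[-1]}x=\exp x$, $\log^{[k]}x=\log(\log^{[k-1]}x)$ for $k\ge1$. Index-pair: for $k\ge q+1\ge1$ let $\rho_f(k,q)=\limsup_{\sigma\to+\infty}\frac{\log^{[k]}M_f(\sigma)}{\log^{[q]}\sigma}$ (the same formula is used for shifted indices). $f$ has index-pair $(1,1)$ if $0<\rho_f(1,1)<\infty$; otherwise $f$ has index-pair $(k,q)\neq(1,1)$, $k\ge q+1\ge1$, if $\delta_{k-q,0}<\rho_f(k,q)<\infty$ and $\rho_f(k-1,q-1)$ is not a positive real number, where $\delta_{i,j}=1$ if $i=j$ and $0$ otherwise. Relative Ritt orders: if $f$ and $g$ have index-pairs $(k,q)$ and $(k,p)$ with $k\ge q+1\ge1$, $k\ge p+1\ge1$, then $$\rho_g^{(p,q)}(f)=\limsup_{\sigma\to+\infty}\frac{\log^{[p]}M_g^{-1}(M_f(\sigma))}{\log^{[q]}\sigma},\qquad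 \lambda_g^{(p,q)}(f)=\liminf_{\sigma\to+\infty}\frac{\log^{[p]}M_g^{-1}(M_f(\sigma))}{\log^{[q]}\sigma}$$ are the $(p,q)$-th relative Ritt order and lower order of $f$ with respect to $g$; for other pairs of functions and indices the definition is the same with the letters changed (so here $f,g,h$ have index-pairs $(k,q),(k,p),(k,m)$ for some $k$). Convention: these quantities lie in $[0,\infty]$; quotients are taken with $a/0=\infty$ for $a>0$ and $a/\infty=0$ for $a<\infty$, and relations are asserted when every quotient is meaningful (no $0/0$ or $\infty/\infty$). *)

theory Defs
  imports "HOL-Analysis.Analysis"
begin

class complex_banach = banach +
  fixes scaleC :: "complex \<Rightarrow> 'a \<Rightarrow> 'a"  (infixr "*\<^sub>C" 75)
  assumes scaleC_add_right: "c *\<^sub>C (x + y) = c *\<^sub>C x + c *\<^sub>C y"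
    and scaleC_add_left: "(c + d) *\<^sub>C x = c *\<^sub>C x + d *\<^sub>C x"
    and scaleC_scaleC: "c *\<^sub>C (d *\<^sub>C x) = (c * d) *\<^sub>C x"
    and scaleC_of_real: "complex_of_real r *\<^sub>C x = r *\<^sub>R x"
    and norm_scaleC: "norm (c *\<^sub>C x) = cmod c * norm x"

instantiation complex :: complex_banach
begin

definition scaleC_complex :: "complex \<Rightarrow> complex \<Rightarrow> complex"
  where "scaleC_complex = (*)"

instance
  by standard (simp_all add: scaleC_complex_def algebra_simps norm_mult scaleR_conv_of_real)

end

text \<open>Logarithm of a non-negative real with \<open>log 0 = -\<infinity>\<close>; coefficients of a series may vanish,
  while \<open>ln 0 = 0\<close> in the library.\<close>

definition elog :: "real \<Rightarrow> ereal"
  where "elog x = (if x = 0 then -\<infinity> else ereal (ln x))"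

text \<open>The sequences are indexed from 1 on; \<open>a 0\<close> and \<open>l 0\<close> are irrelevant.\<close>

definition vvds :: "(complex \<Rightarrow> 'a::complex_banach) \<Rightarrow> bool"
  where "vvds f \<longleftrightarrow>
    (\<exists>(a :: nat \<Rightarrow> 'a) (l :: nat \<Rightarrow> real).
       (\<forall>n\<ge>1. 0 < l n \<and> l n < l (Suc n)) \<and>
       filterlim l at_top sequentially \<and>
       limsup (\<lambda>n. ereal (ln (real n) / l n)) < \<infinity> \<and>
       limsup (\<lambda>n. elog (norm (a n)) / ereal (l n)) = -\<infinity> \<and>
       (\<forall>s. (\<lambda>n. exp (s * of_real (l (Suc n))) *\<^sub>C a (Suc n)) sums f s)) \<and>
    f \<noteq> (\<lambda>_. 0)"

definition max_modulus :: "(complex \<Rightarrow> 'a::complex_banach) \<Rightarrow> real \<Rightarrow> real"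
  where "max_modulus f \<sigma> = (SUP t. norm (f (Complex \<sigma> t)))"

definition ilog :: "int \<Rightarrow> real \<Rightarrow> real"
  where "ilog k = (if k < 0 then exp ^^ nat (- k) else ln ^^ nat k)"

definition index_order :: "(complex \<Rightarrow> 'a::complex_banach) \<Rightarrow> int \<Rightarrow> int \<Rightarrow> ereal"
  where "index_order f k q =
    Limsup at_top (\<lambda>\<sigma>. ereal (ilog k (max_modulus f \<sigma>) / ilog q \<sigma>))"

definition has_index_pair :: "(complex \<Rightarrow> 'a::complex_banach) \<Rightarrow> int \<Rightarrow> int \<Rightarrow> bool"
  where "has_index_pair f k q \<longleftrightarrow>
    (if 0 < index_order f 1 1 \<and> index_order f 1 1 < \<infinity> then k = 1 \<and> q = 1
     else (k, q) \<noteq> (1, 1) \<and> k \<ge> q + 1 \<and> q + 1 \<ge> 1 \<and>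
       (if k - q = 0 then 1 else 0) < index_order f k q \<and> index_order f k q < \<infinity> \<and>
       \<not> (0 < index_order f (k - 1) (q - 1) \<and> index_order f (k - 1) (q - 1) < \<infinity>))"

text \<open>The maximum modulus of a non-zero series is a strictly increasing bijection from the reals
  onto the positive reals, so \<open>inv (max_modulus g)\<close> is its genuine inverse on the values
  \<open>max_modulus f \<sigma>\<close>. The (upper) order of \<open>f\<close> with respect to \<open>g\<close>
  is \<open>rel_order p q g f\<close>.\<close>

definition rel_order ::
  "int \<Rightarrow> int \<Rightarrow> (complex \<Rightarrow> 'b::complex_banach) \<Rightarrow> (complex \<Rightarrow> 'a::complex_banach) \<Rightarrow> ereal"
  where "rel_order p q g f =
    Limsup at_top (\<lambda>\<sigma>. ereal (ilog p (inv (max_modulus g) (max_modulus f \<sigma>)) / ilog q \<sigma>))"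

definition rel_lower_order ::
  "int \<Rightarrow> int \<Rightarrow> (complex \<Rightarrow> 'b::complex_banach) \<Rightarrow> (complex \<Rightarrow> 'a::complex_banach) \<Rightarrow> ereal"
  where "rel_lower_order p q g f =
    Liminf at_top (\<lambda>\<sigma>. ereal (ilog p (inv (max_modulus g) (max_modulus f \<sigma>)) / ilog q \<sigma>))"

text \<open>Division on \<open>ereal\<close> already satisfies \<open>a / 0 = \<infinity>\<close> for \<open>a > 0\<close> and \<open>a / \<infinity> = 0\<close> for finite \<open>a\<close>;
  only \<open>0 / 0\<close> and \<open>\<infinity> / \<infinity>\<close> have to be excluded.\<close>

definition meaningful_quotient :: "ereal \<Rightarrow> ereal \<Rightarrow> bool"
  where "meaningful_quotient a b \<longleftrightarrow> \<not> (a = 0 \<and> b = 0) \<and> \<not> (a = \<infinity> \<and> b = \<infinity>)"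

end

(* Factor the first exponential out of a series: f s = exp (c s) D s, with c > 0, where the exponents of
   D are non-negative and start at 0. Exponentials with non-negative exponents satisfy a four-point
   mean value property up to an error of fourth order, so the supremum S of |D| over vertical
   lines satisfies 2 S(x) <= S(x + r) + S(x - r) + C r^4. Hence S is approximately convex, and being bounded
   near -oo it is nondecreasing; it is positive since D tends to its non-zero constant term at -oo.
   Therefore M_f = exp (c x) S(x) is an increasing bijection onto the positive reals.

   Now T = M_g^{-1} o M_f is a bijection of the line preserving the filter at +oo, and
     log^[p] T(x) / log^[q] x = (log^[m] M_h^{-1}(M_f x) / log^[q] x) / (log^[m] M_h^{-1}(M_g (T x)) / log^[p] (T x)),
   where the two factors on the right have the limits superior and inferior of f and of g with respect
   to h; the inequalities are those for limits of a quotient of eventually positive functions. *)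
theory Submission
  imports Defs
begin

section \<open>Complex scalar multiplication on the coefficient space\<close>

lemma scaleC_zero_right [simp]: "c *\<^sub>C (0::'a::complex_banach) = 0"
  using norm_scaleC[of c "0::'a"] by simp

lemma scaleC_diff_left: "(c - d) *\<^sub>C x = c *\<^sub>C x - d *\<^sub>C (x::'a::complex_banach)"
  using scaleC_add_left[of "c - d" d x] by (simp add: algebra_simps)

lemma bounded_linear_scaleC_right: "bounded_linear (\<lambda>x::'a::complex_banach. c *\<^sub>C x)"
proof (rule bounded_linear_intro[where K = "cmod c"])
  show "c *\<^sub>C (r *\<^sub>R x) = r *\<^sub>R (c *\<^sub>C x)" for r and x :: 'a
    by (simp add: scaleC_scaleC mult.commute flip: scaleC_of_real)
qed (simp_all add: scaleC_add_right norm_scaleC mult.commute)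

lemma norm_exp_scaleC:
  "norm (exp (s * of_real l) *\<^sub>C (x::'a::complex_banach)) = norm x * exp (Re s * l)"
  by (simp add: norm_scaleC norm_exp_eq_Re)

section \<open>Elementary estimates for the exponential function\<close>

text \<open>The cubic Taylor polynomials at the four points \<open>x\<close>, \<open>-x\<close>,
  \<open>ix\<close>, \<open>-ix\<close> add up to 4, because powers of degree 1, 2 and 3 cancel over
  the fourth roots of unity. Each remainder is at most \<open>x ^ 4 * exp x / 6\<close>.\<close>

lemma four_point_exp_bound:
  fixes x :: real
  assumes "0 \<le> x"
  shows "cmod (exp (of_real x) + exp (- of_real x) + exp (\<i> * of_real x) + exp (- (\<i> * of_real x)) - 4)
    \<le> x ^ 4 * exp x"
proof -
  define R :: "complex \<Rightarrow> complex" where "R z = exp z - (\<Sum>k\<le>3. z ^ k / fact k)" for z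
  have R: "cmod (R z) \<le> exp x * x ^ 4 / 6" if "cmod z = x" for z
  proof -
    have "cmod (R z) \<le> exp \<bar>Re z\<bar> * cmod z ^ Suc 3 / fact 3"
      unfolding R_def by (rule Taylor_exp)
    also have "\<dots> \<le> exp x * x ^ 4 / 6"
      using abs_Re_le_cmod[of z] that by (simp add: fact_numeral divide_right_mono mult_right_mono)
    finally show ?thesis .
  qed
  let ?x = "of_real x :: complex"
  have "exp ?x + exp (- ?x) + exp (\<i> * ?x) + exp (- (\<i> * ?x)) - 4
      = R ?x + R (- ?x) + R (\<i> * ?x) + R (- (\<i> * ?x))"
    by (simp add: R_def eval_nat_numeral field_simps)
  also have "cmod \<dots> \<le> exp x * x ^ 4 / 6 + exp x * x ^ 4 / 6 + exp x * x ^ 4 / 6 + exp x * x ^ 4 / 6"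
    using assms by (intro norm_triangle_mono R) (auto simp: norm_mult)
  also have "\<dots> \<le> x ^ 4 * exp x"
    using assms by (simp add: field_simps)
  finally show ?thesis .
qed

lemma abs_exp_diff_le: "\<bar>exp x - exp y\<bar> \<le> \<bar>x - y\<bar> * exp (max x y)" for x y :: real
proof -
  have *: "exp v - exp u \<le> (v - u) * exp v" if "u \<le> v" for u v :: real
    using exp_ge_add_one_self[of "u - v"] mult_left_mono[of "1 + (u - v)" "exp (u - v)" "exp v"]
    by (simp add: exp_diff algebra_simps)
  show ?thesis
    using *[of x y] *[of y x] by (cases "x \<le> y") (auto simp: abs_if max_def)
qed

text \<open>\<open>x ^ 4 / 24\<close> is a single term of the exponential series. The bound trades a
  fourth power of an exponent for a unit shift of the abscissa.\<close>

lemma power4_le_exp: "x ^ 4 \<le> 24 * exp x" if "0 \<le> x" for x :: real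
  using sum_le_suminf[OF summable_exp[of x], of "{4}"] that
  by (simp add: exp_def fact_numeral field_simps scaleR_conv_of_real)

section \<open>Monotonicity from second differences\<close>

text \<open>A convex function that drops from \<open>x\<close> to \<open>y\<close> is unbounded to
  the left of \<open>x\<close>. The error \<open>C * r ^ 4\<close> does no harm, since for small
  \<open>r\<close> a quadratic perturbation dominates it.\<close>

lemma nondecreasing_if_second_difference_small:
  fixes S :: "real \<Rightarrow> real"
  assumes cont: "continuous_on UNIV S"
    and bdd: "\<And>y. \<exists>B. \<forall>z\<le>y. S z \<le> B"
    and second: "\<And>y. \<exists>C. \<forall>z\<le>y. \<forall>r. 0 < r \<longrightarrow> r \<le> 1 \<longrightarrow> 2 * S z \<le> S (z + r) + S (z - r) + C * r ^ 4"
    and "x \<le> y"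
  shows "S x \<le> S y"
proof (rule ccontr)
  assume "\<not> S x \<le> S y"
  define d where "d = S x - S y"
  have d: "0 < d" and xy: "x < y"
    using \<open>\<not> S x \<le> S y\<close> \<open>x \<le> y\<close> by (auto simp: d_def less_le)
  (* S plus a line of slope e plus k (z - x)^2 has an interior maximum on [w, y], where the k-term
     violates the lower bound on second differences. *)
  define e where "e = d / (2 * (y - x))"
  have e: "0 < e" using d xy by (simp add: e_def)
  have eyx: "e * (y - x) = d / 2" using xy by (simp add: e_def divide_simps)
  obtain B where B: "S z \<le> B" if "z \<le> y" for z using bdd by blast
  \<comment> \<open>Far enough to the left that the line of slope \<open>e\<close> outweighs any
    excess of \<open>S w\<close> over \<open>S x\<close>: the linear part alone puts
    \<open>w\<close> at least \<open>d / 2\<close> below \<open>x\<close>.\<close>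
  define w where "w = x - (B - S x + d / 2) / e"
  have wx: "w < x" using B[OF \<open>x \<le> y\<close>] d e by (simp add: w_def divide_pos_pos)
  have ewx: "e * (w - x) = - (B - S x + d / 2)" using e by (simp add: w_def)
  \<comment> \<open>Normalised so that the quadratic term adds at most \<open>d / 4\<close> on
    \<open>[w, y]\<close>, which keeps both endpoints below \<open>T x\<close>.\<close>
  define k where "k = d / (4 * (y - w)\<^sup>2)"
  have k: "0 < k" using d xy wx by (simp add: k_def)
  have kyw: "k * (y - w)\<^sup>2 = d / 4" using xy wx by (simp add: k_def)
  have kle: "k * (z - x)\<^sup>2 \<le> d / 4" if "w \<le> z" "z \<le> y" for z
  proof -
    have "(z - x)\<^sup>2 \<le> (y - w)\<^sup>2"
      using that wx xy by (intro abs_le_square_iff[THEN iffD1]) auto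
    then show ?thesis using k kyw by (metis mult_left_mono less_imp_le)
  qed
  define T where "T z = S z + e * (z - x) + k * (z - x)\<^sup>2" for z
  have Ty: "T y < T x"
    using kle[of y] eyx d wx xy by (simp add: T_def d_def)
  have Tw: "T w < T x"
    using kle[of w] ewx d wx xy B[of w] by (simp add: T_def)
  have "continuous_on {w..y} T"
    unfolding T_def by (intro continuous_intros continuous_on_subset[OF cont]) auto
  then obtain z where z: "w \<le> z" "z \<le> y" and max: "\<And>u. w \<le> u \<Longrightarrow> u \<le> y \<Longrightarrow> T u \<le> T z"
    using continuous_attains_sup[of "{w..y}" T] wx xy by fastforce
  have "T x \<le> T z" using max wx xy by simp
  with Ty Tw z have "w < z" "z < y" by (auto simp: order.order_iff_strict)
  obtain C where C: "2 * S z \<le> S (z + r) + S (z - r) + C * r ^ 4" if "0 < r" "r \<le> 1" for r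
    using second z(2) by metis
  \<comment> \<open>The bound \<open>k / (\<bar>C\<bar> + 1)\<close> gives
    \<open>C * r ^ 4 \<le> k * r\<^sup>2\<close>, half of what the quadratic term contributes to the
    second difference of \<open>T\<close>; the others keep \<open>z - r\<close> and
    \<open>z + r\<close> inside \<open>[w, y]\<close> and \<open>r \<le> 1\<close>.\<close>
  define r where "r = min (min 1 (k / (\<bar>C\<bar> + 1))) (min (z - w) (y - z))"
  have r: "0 < r" "r \<le> 1" "r \<le> k / (\<bar>C\<bar> + 1)" "r \<le> z - w" "r \<le> y - z"
    using k \<open>w < z\<close> \<open>z < y\<close> by (auto simp: r_def)
  have "C * r ^ 4 \<le> \<bar>C\<bar> * r ^ 3"
    using r power_decreasing[of 3 4 r] by (intro mult_mono) auto
  also have "\<dots> = (\<bar>C\<bar> * r) * r\<^sup>2" by (simp add: power2_eq_square power3_eq_cube)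
  also have "\<bar>C\<bar> * r \<le> (\<bar>C\<bar> + 1) * r" using r by (simp add: algebra_simps)
  also have "\<dots> \<le> k" using r(3) by (simp add: pos_le_divide_eq mult.commute)
  finally have "C * r ^ 4 \<le> k * r\<^sup>2" using r by simp
  moreover have "T (z + r) \<le> T z" "T (z - r) \<le> T z"
    using r \<open>w < z\<close> \<open>z < y\<close> by (auto intro!: max)
  moreover have "T (z + r) + T (z - r) - 2 * T z = S (z + r) + S (z - r) - 2 * S z + 2 * (k * r\<^sup>2)"
    by (simp add: T_def power2_eq_square algebra_simps)
  moreover have "0 < k * r\<^sup>2" using k r by simp
  ultimately show False using C[OF r(1,2)] by linarith
qed

section \<open>Dirichlet series with non-negative exponents\<close>

text \<open>Models the factor that remains when the leading exponential is divided out. The growth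
  conditions are condensed into absolute convergence at every abscissa.\<close>

locale dirichlet_series =
  fixes l :: "nat \<Rightarrow> real" and a :: "nat \<Rightarrow> 'a::complex_banach"
  assumes nonneg: "0 \<le> l n"
    and summable_majorant: "summable (\<lambda>n. norm (a n) * exp (x * l n))"
begin

definition D :: "complex \<Rightarrow> 'a"
  where "D s = (\<Sum>n. exp (s * of_real (l n)) *\<^sub>C a n)"

text \<open>Nondecreasing in \<open>x\<close> because the exponents are non-negative, so one value
  serves as error constant on a whole left half-plane.\<close>

definition majorant :: "real \<Rightarrow> real"
  where "majorant x = (\<Sum>n. norm (a n) * exp (x * l n))"

lemma sums_D: "(\<lambda>n. exp (s * of_real (l n)) *\<^sub>C a n) sums D s"
  unfolding D_def
  by (rule summable_sums, rule summable_norm_cancel)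
    (simp only: norm_exp_scaleC summable_majorant)

text \<open>Reduces the estimates for combinations of values of \<open>D\<close> to bounds on single
  terms.\<close>

lemma norm_le_majorant:
  fixes b :: "nat \<Rightarrow> 'a"
  assumes "b sums B" "\<And>n. norm (b n) \<le> c * (norm (a n) * exp (x * l n))"
  shows "norm B \<le> c * majorant x"
proof -
  have "norm (suminf b) \<le> (\<Sum>n. c * (norm (a n) * exp (x * l n)))"
    by (intro norm_suminf_le assms summable_mult summable_majorant)
  then show ?thesis
    using assms(1) by (simp add: sums_iff majorant_def suminf_mult[OF summable_majorant])
qed

lemma majorant_nonneg: "0 \<le> majorant x"
  unfolding majorant_def by (intro suminf_nonneg summable_majorant) simp

lemma majorant_mono: "x \<le> y \<Longrightarrow> majorant x \<le> majorant y"
  unfolding majorant_def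
  by (intro suminf_le summable_majorant mult_left_mono) (auto intro: mult_right_mono nonneg)

lemma norm_D_le_majorant: "norm (D s) \<le> majorant (Re s)"
  using norm_le_majorant[OF sums_D, of s 1 "Re s"] by (simp add: norm_exp_scaleC)

lemma bdd_above_norm_D: "bdd_above (range (\<lambda>t. norm (D (Complex x t))))"
  using norm_D_le_majorant[of "Complex x _"] by (auto intro!: bdd_aboveI[of _ "majorant x"])

lemma norm_D_le_max_modulus: "norm (D s) \<le> max_modulus D (Re s)"
  unfolding max_modulus_def
  using cSUP_upper[OF UNIV_I bdd_above_norm_D, of "Re s" "Im s"] by simp

lemma max_modulus_le: "(\<And>t. norm (D (Complex x t)) \<le> B) \<Longrightarrow> max_modulus D x \<le> B"
  unfolding max_modulus_def by (intro cSUP_least) auto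

lemma max_modulus_le_majorant: "max_modulus D x \<le> majorant x"
  using norm_D_le_majorant[of "Complex x _"] by (intro max_modulus_le) simp

text \<open>Each term obeys a mean value bound with an extra factor \<open>l n\<close>; absorbing it
  by \<open>l n \<le> exp (l n)\<close> moves the abscissa from \<open>R\<close> to
  \<open>R + 1\<close>.\<close>

lemma max_modulus_diff_le:
  assumes "x \<le> R" "y \<le> R"
  shows "max_modulus D x \<le> max_modulus D y + \<bar>x - y\<bar> * majorant (R + 1)"
proof (rule max_modulus_le)
  fix t
  let ?e = "\<lambda>x n. exp (Complex x t * of_real (l n))"
  have "norm (D (Complex x t) - D (Complex y t)) \<le> \<bar>x - y\<bar> * majorant (R + 1)"
  proof (rule norm_le_majorant)
    show "(\<lambda>n. ?e x n *\<^sub>C a n - ?e y n *\<^sub>C a n) sums (D (Complex x t) - D (Complex y t))"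
      by (intro sums_diff sums_D)
    fix n
    \<comment> \<open>The factor depending on \<open>t\<close> has modulus 1, so only real
      exponentials remain to be compared.\<close>
    have split: "?e z n = of_real (exp (z * l n)) * exp (\<i> * of_real (t * l n))" for z
      by (simp add: Complex_eq ring_distribs exp_add exp_of_real[symmetric] mult_ac)
    have "cmod (?e x n - ?e y n) = \<bar>exp (x * l n) - exp (y * l n)\<bar>"
      unfolding split left_diff_distrib[symmetric] norm_mult of_real_diff[symmetric]
      by (simp del: of_real_diff)
    also have "\<dots> \<le> \<bar>x * l n - y * l n\<bar> * exp (max (x * l n) (y * l n))"
      by (rule abs_exp_diff_le)
    also have "\<bar>x * l n - y * l n\<bar> = \<bar>x - y\<bar> * l n"
      using nonneg[of n] by (simp add: abs_mult flip: left_diff_distrib)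
    also have "\<dots> * exp (max (x * l n) (y * l n)) \<le> \<bar>x - y\<bar> * exp (l n) * exp (R * l n)"
    proof (intro mult_mono mult_left_mono)
      show "l n \<le> exp (l n)" using exp_ge_add_one_self[of "l n"] by linarith
      show "exp (max (x * l n) (y * l n)) \<le> exp (R * l n)"
        using nonneg[of n] assms by (simp add: mult_right_mono)
    qed (simp_all add: nonneg)
    also have "\<dots> = \<bar>x - y\<bar> * exp ((R + 1) * l n)"
      by (simp add: distrib_right exp_add)
    finally have "cmod (?e x n - ?e y n) \<le> \<bar>x - y\<bar> * exp ((R + 1) * l n)" .
    from mult_right_mono[OF this norm_ge_zero[of "a n"]]
    show "norm (?e x n *\<^sub>C a n - ?e y n *\<^sub>C a n)
        \<le> \<bar>x - y\<bar> * (norm (a n) * exp ((R + 1) * l n))"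
      unfolding scaleC_diff_left[symmetric] norm_scaleC by (simp add: mult_ac)
  qed
  then show "norm (D (Complex x t)) \<le> max_modulus D y + \<bar>x - y\<bar> * majorant (R + 1)"
    using norm_triangle_sub[of "D (Complex x t)" "D (Complex y t)"]
      norm_D_le_max_modulus[of "Complex y t"] by simp
qed

lemma continuous_on_max_modulus: "continuous_on UNIV (max_modulus D)"
proof -
  have "continuous (at x) (max_modulus D)" for x
    unfolding continuous_at_real_range real_norm_def
  proof (intro allI impI)
    fix e :: real assume "0 < e"
    let ?M = "majorant (x + 1 + 1) + 1"
    have M: "0 < ?M" using majorant_nonneg[of "x + 1 + 1"] by simp
    show "\<exists>d>0. \<forall>y. \<bar>y - x\<bar> < d \<longrightarrow> \<bar>max_modulus D y - max_modulus D x\<bar> < e"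
    proof (intro exI[where x = "min 1 (e / ?M)"] conjI allI impI)
      show "0 < min 1 (e / ?M)" using \<open>0 < e\<close> M by simp
      fix y assume y: "\<bar>y - x\<bar> < min 1 (e / ?M)"
      then have "y \<le> x + 1" by (simp add: abs_less_iff)
      then have "\<bar>max_modulus D y - max_modulus D x\<bar> \<le> \<bar>y - x\<bar> * majorant (x + 1 + 1)"
        using max_modulus_diff_le[of y "x + 1" x] max_modulus_diff_le[of x "x + 1" y]
        by (simp add: abs_minus_commute abs_le_iff algebra_simps)
      also have "\<dots> \<le> \<bar>y - x\<bar> * ?M" by (simp add: mult_left_mono)
      also have "\<dots> < e" using y M by (simp add: pos_less_divide_eq)
      finally show "\<bar>max_modulus D y - max_modulus D x\<bar> < e" .
    qed
  qed
  then show ?thesis by (simp add: continuous_at_imp_continuous_on)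
qed

text \<open>\<open>4 * D s\<close> is compared with the sum of \<open>D\<close> over
  \<open>s + r\<close>, \<open>s - r\<close>, \<open>s + ir\<close>, \<open>s - ir\<close>. The
  vertical shifts stay on the line of abscissa \<open>x\<close>, so their share
  \<open>2 * max_modulus D x\<close> is finally subtracted from both sides.\<close>

lemma max_modulus_four_points:
  assumes r: "0 < r" "r \<le> 1" and "x \<le> R"
  shows "2 * max_modulus D x
    \<le> max_modulus D (x + r) + max_modulus D (x - r) + 24 * majorant (R + 2) * r ^ 4"
proof -
  have "max_modulus D x
    \<le> (max_modulus D (x + r) + max_modulus D (x - r) + 2 * max_modulus D x
        + 24 * r ^ 4 * majorant (R + 2)) / 4"
  proof (rule max_modulus_le)
    fix t
    define s where "s = Complex x t"
    define e where "e z n = exp (z * complex_of_real (l n))" for z n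
    have e_add: "e (z + w) n = e z n * e w n" for z w n
      by (simp add: e_def ring_distribs exp_add)
    let ?r = "of_real r :: complex"
    define E where "E = D (s + ?r) + D (s + - ?r) + D (s + \<i> * ?r) + D (s + - (\<i> * ?r))
      - (D s + D s + D s + D s)"
    have "norm E \<le> 24 * r ^ 4 * majorant (R + 2)"
    proof (rule norm_le_majorant)
      show "(\<lambda>n. e (s + ?r) n *\<^sub>C a n + e (s + - ?r) n *\<^sub>C a n + e (s + \<i> * ?r) n *\<^sub>C a n
          + e (s + - (\<i> * ?r)) n *\<^sub>C a n
          - (e s n *\<^sub>C a n + e s n *\<^sub>C a n + e s n *\<^sub>C a n + e s n *\<^sub>C a n)) sums E"
        unfolding E_def e_def by (intro sums_diff sums_add sums_D)
      fix n
      define y where "y = r * l n"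
      have y: "0 \<le> y" "y \<le> l n" using nonneg[of n] r by (simp_all add: y_def mult_left_le_one_le)
      \<comment> \<open>Isolates \<open>r ^ 4\<close> at the cost of one factor
        \<open>exp (l n)\<close>; \<open>exp y \<le> exp (l n)\<close> costs a second one, whence
        \<open>R + 2\<close>.\<close>
      have "y ^ 4 \<le> r ^ 4 * (24 * exp (l n))"
        using power4_le_exp[OF nonneg, of n] r by (simp add: y_def power_mult_distrib)
      have "e (s + ?r) n + e (s + - ?r) n + e (s + \<i> * ?r) n + e (s + - (\<i> * ?r)) n
          - (e s n + e s n + e s n + e s n)
        = e s n * (e ?r n + e (- ?r) n + e (\<i> * ?r) n + e (- (\<i> * ?r)) n - 4)"
        unfolding e_add by (simp add: algebra_simps)
      also have "e ?r n + e (- ?r) n + e (\<i> * ?r) n + e (- (\<i> * ?r)) n - 4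
        = exp (of_real y) + exp (- of_real y) + exp (\<i> * of_real y) + exp (- (\<i> * of_real y)) - 4"
        by (simp add: e_def y_def mult.assoc)
      finally have "cmod (e (s + ?r) n + e (s + - ?r) n + e (s + \<i> * ?r) n + e (s + - (\<i> * ?r)) n
          - (e s n + e s n + e s n + e s n)) \<le> cmod (e s n) * (y ^ 4 * exp y)"
        using four_point_exp_bound[OF y(1)] by (simp add: norm_mult mult_left_mono)
      also have "cmod (e s n) = exp (x * l n)"
        by (simp add: e_def s_def norm_exp_eq_Re)
      also have "exp (x * l n) * (y ^ 4 * exp y)
          \<le> exp (R * l n) * (r ^ 4 * (24 * exp (l n)) * exp (l n))"
        using y nonneg[of n] \<open>x \<le> R\<close> \<open>y ^ 4 \<le> _\<close> r
        by (intro mult_mono) (auto intro: mult_right_mono)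
      also have "\<dots> = 24 * r ^ 4 * exp ((R + 2) * l n)"
        by (simp add: algebra_simps flip: exp_add)
      finally have "cmod (e (s + ?r) n + e (s + - ?r) n + e (s + \<i> * ?r) n + e (s + - (\<i> * ?r)) n
          - (e s n + e s n + e s n + e s n)) \<le> 24 * r ^ 4 * exp ((R + 2) * l n)" .
      from mult_right_mono[OF this norm_ge_zero[of "a n"]]
      show "norm (e (s + ?r) n *\<^sub>C a n + e (s + - ?r) n *\<^sub>C a n + e (s + \<i> * ?r) n *\<^sub>C a n
          + e (s + - (\<i> * ?r)) n *\<^sub>C a n
          - (e s n *\<^sub>C a n + e s n *\<^sub>C a n + e s n *\<^sub>C a n + e s n *\<^sub>C a n))
        \<le> 24 * r ^ 4 * (norm (a n) * exp ((R + 2) * l n))"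
        unfolding scaleC_diff_left[symmetric] scaleC_add_left[symmetric] norm_scaleC
        by (simp only: mult_ac)
    qed
    moreover have "norm (D (s + ?r)) \<le> max_modulus D (x + r)"
      "norm (D (s + - ?r)) \<le> max_modulus D (x - r)"
      "norm (D (s + \<i> * ?r)) \<le> max_modulus D x" "norm (D (s + - (\<i> * ?r))) \<le> max_modulus D x"
      using norm_D_le_max_modulus[of "s + ?r"] norm_D_le_max_modulus[of "s + - ?r"]
        norm_D_le_max_modulus[of "s + \<i> * ?r"] norm_D_le_max_modulus[of "s + - (\<i> * ?r)"]
      by (simp_all add: s_def)
    moreover have "4 *\<^sub>R D s = D (s + ?r) + D (s + - ?r) + D (s + \<i> * ?r) + D (s + - (\<i> * ?r)) - E"
      using scaleR_add_left[of 2 2 "D s"] by (simp add: E_def scaleR_2)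
    then have "4 * norm (D s) = norm (D (s + ?r) + D (s + - ?r) + D (s + \<i> * ?r) + D (s + - (\<i> * ?r)) - E)"
      by (metis abs_numeral norm_scaleR)
    moreover have "\<dots> \<le> norm (D (s + ?r)) + norm (D (s + - ?r)) + norm (D (s + \<i> * ?r))
        + norm (D (s + - (\<i> * ?r))) + norm E"
      by (intro norm_triangle_ineq4[THEN order_trans] add_mono norm_triangle_mono order_refl)
    ultimately have "4 * norm (D s) \<le> max_modulus D (x + r) + max_modulus D (x - r)
        + max_modulus D x + max_modulus D x + 24 * r ^ 4 * majorant (R + 2)"
      by linarith
    then show "norm (D (Complex x t))
      \<le> (max_modulus D (x + r) + max_modulus D (x - r) + 2 * max_modulus D x
        + 24 * r ^ 4 * majorant (R + 2)) / 4"
      unfolding s_def[symmetric] by simp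
  qed
  then show ?thesis by (simp add: mult_ac)
qed

lemma max_modulus_mono:
  assumes "x \<le> y"
  shows "max_modulus D x \<le> max_modulus D y"
proof (rule nondecreasing_if_second_difference_small[OF continuous_on_max_modulus _ _ assms])
  show "\<exists>B. \<forall>z\<le>y. max_modulus D z \<le> B" for y
    using max_modulus_le_majorant majorant_mono order_trans by blast
  show "\<exists>C. \<forall>z\<le>y. \<forall>r>0. r \<le> 1 \<longrightarrow>
      2 * max_modulus D z \<le> max_modulus D (z + r) + max_modulus D (z - r) + C * r ^ 4" for y
    using max_modulus_four_points by blast
qed

text \<open>Far to the left all terms but \<open>a 0\<close> are negligible, because their exponents
  are at least \<open>c\<close>; monotonicity then carries positivity to the right.\<close>

lemma max_modulus_pos:
  assumes l0: "l 0 = 0" and a0: "a 0 \<noteq> 0" and c: "0 < c" "\<And>n. 0 < n \<Longrightarrow> c \<le> l n"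
  shows "0 < max_modulus D x"
proof -
  define M where "M = majorant 0 + 1"
  have M: "0 < M" using majorant_nonneg[of 0] by (simp add: M_def)
  \<comment> \<open>The logarithm makes \<open>exp (c * y) * M \<le> norm (a 0)\<close>, with
    \<open>M\<close> strictly above \<open>majorant 0\<close>. The bound \<open>y \<le> 0\<close>
    turns \<open>c \<le> l n\<close> into \<open>y * l n \<le> c * y\<close>, and
    \<open>y \<le> x\<close> serves monotonicity.\<close>
  define y where "y = min (min x 0) (ln (norm (a 0) / M) / c)"
  have "c * y \<le> ln (norm (a 0) / M)"
    using c(1) by (simp add: y_def min_def field_simps)
  then have "exp (c * y) \<le> norm (a 0) / M"
    using M a0 by (metis divide_pos_pos exp_le_cancel_iff exp_ln zero_less_norm_iff)
  then have "exp (c * y) * M \<le> norm (a 0)"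
    using M by (simp add: pos_le_divide_eq)
  have "norm (D (of_real y) - a 0) \<le> exp (c * y) * majorant 0"
  proof (rule norm_le_majorant)
    show "(\<lambda>n. exp (of_real y * of_real (l n)) *\<^sub>C a n - (if n = 0 then a n else 0)) sums (D (of_real y) - a 0)"
      by (intro sums_diff sums_D sums_single)
    fix n
    show "norm (exp (of_real y * of_real (l n)) *\<^sub>C a n - (if n = 0 then a n else 0))
        \<le> exp (c * y) * (norm (a n) * exp (0 * l n))"
    proof (cases "n = 0")
      case True
      then show ?thesis using scaleC_of_real[of 1 "a 0"] by (simp add: l0)
    next
      case False
      then have "y * l n \<le> c * y"
        using c(2)[of n] mult_left_mono_neg[of c "l n" y] by (simp add: y_def mult.commute)
      then show ?thesis
        using False norm_exp_scaleC[of "of_real y" "l n" "a n"] by (simp add: mult.commute mult_left_mono)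
    qed
  qed
  also have "\<dots> < exp (c * y) * M" by (simp add: M_def)
  also note \<open>\<dots> \<le> norm (a 0)\<close>
  finally have "D (of_real y) \<noteq> 0" by auto
  then have "0 < max_modulus D y"
    using norm_D_le_max_modulus[of "of_real y"] by (metis Re_complex_of_real less_le_trans zero_less_norm_iff)
  also have "\<dots> \<le> max_modulus D x" by (rule max_modulus_mono) (simp add: y_def)
  finally show ?thesis .
qed

text \<open>The exponential factor has constant modulus on each vertical line and therefore leaves
  the supremum.\<close>

lemma max_modulus_exp_mult:
  fixes f :: "complex \<Rightarrow> 'a"
  assumes f: "\<And>s. f s = exp (s * of_real c) *\<^sub>C D s"
  shows "max_modulus f x = exp (c * x) * max_modulus D x"
proof -
  have norm_f: "norm (f (Complex x t)) = exp (c * x) * norm (D (Complex x t))" for t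
    unfolding f norm_exp_scaleC by (simp add: mult.commute)
  have bdd: "bdd_above (range (\<lambda>t. norm (f (Complex x t))))"
    unfolding norm_f using norm_D_le_max_modulus[of "Complex x _"]
    by (intro bdd_aboveI[of _ "exp (c * x) * max_modulus D x"]) auto
  show ?thesis
  proof (rule antisym)
    show "max_modulus f x \<le> exp (c * x) * max_modulus D x"
      unfolding max_modulus_def[of f] norm_f
      using norm_D_le_max_modulus[of "Complex x _"] by (intro cSUP_least) auto
    have "max_modulus D x \<le> max_modulus f x / exp (c * x)"
      using cSUP_upper[OF UNIV_I bdd] unfolding max_modulus_def[of f, symmetric]
      by (intro max_modulus_le) (simp add: norm_f pos_le_divide_eq mult.commute)
    then show "exp (c * x) * max_modulus D x \<le> max_modulus f x"
      by (simp add: pos_le_divide_eq mult.commute)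
  qed
qed

end

section \<open>From the defining conditions to the bijectivity of the maximum modulus\<close>

text \<open>The first limsup bounds \<open>ln n\<close> by a multiple of \<open>l n\<close>; the
  second makes the coefficients decay like \<open>exp (K * l n)\<close> for any \<open>K\<close>.
  Together they bring the terms below \<open>1 / n ^ 2\<close>.\<close>

lemma vvds_majorant_summable:
  fixes a :: "nat \<Rightarrow> 'a::complex_banach" and l :: "nat \<Rightarrow> real"
  assumes pos: "\<And>n. 1 \<le> n \<Longrightarrow> 0 < l n"
    and ln: "limsup (\<lambda>n. ereal (ln (real n) / l n)) < \<infinity>"
    and elog: "limsup (\<lambda>n. elog (norm (a n)) / ereal (l n)) = -\<infinity>"
  shows "summable (\<lambda>n. norm (a n) * exp (x * l n))"
proof -
  obtain C where C: "limsup (\<lambda>n. ereal (ln (real n) / l n)) < ereal C"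
    using ln ereal_dense2 by blast
  \<comment> \<open>With this choice
    \<open>exp (K * l n) * exp (x * l n) = exp (- 2 * C * l n)\<close>, and
    \<open>ln n \<le> C * l n\<close> bounds it by \<open>1 / n ^ 2\<close>.\<close>
  define K where "K = - (x + 2 * C)"
  have "\<forall>\<^sub>F n in sequentially. ereal (ln (real n) / l n) < ereal C"
    using C by (rule Limsup_lessD)
  moreover have "\<forall>\<^sub>F n in sequentially. elog (norm (a n)) / ereal (l n) < ereal K"
    using elog by (intro Limsup_lessD) simp
  ultimately have "\<forall>\<^sub>F n in sequentially.
      norm (norm (a n) * exp (x * l n)) \<le> inverse (real n ^ 2)"
    using eventually_ge_at_top[of 1]
  proof eventually_elim
    case (elim n)
    have l: "0 < l n" using pos elim(3) .
    have "ln (real n) \<le> C * l n" using elim(1) l by (simp add: pos_divide_less_eq)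
    show ?case
    proof (cases "a n = 0")
      case False
      then have "ln (norm (a n)) \<le> K * l n"
        using elim(2) l by (simp add: elog_def pos_divide_less_eq)
      then have "norm (a n) \<le> exp (K * l n)"
        using False by (metis exp_le_cancel_iff exp_ln zero_less_norm_iff)
      then have "norm (a n) * exp (x * l n) \<le> exp (K * l n) * exp (x * l n)"
        by (simp add: mult_right_mono)
      also have "\<dots> = exp (- (2 * (C * l n)))"
        by (simp add: K_def algebra_simps flip: exp_add)
      also have "\<dots> \<le> exp (- (2 * ln (real n)))"
        using \<open>ln (real n) \<le> C * l n\<close> by simp
      also have "\<dots> = inverse (real n ^ 2)"
        using elim(3) by (simp add: exp_minus exp_double)
      finally show ?thesis by simp
    qed simp
  qed
  then show ?thesis
    by (rule summable_comparison_test_ev) (simp add: inverse_power_summable)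
qed

text \<open>The series is reindexed from its first non-vanishing coefficient, whose exponent is the
  \<open>c\<close> factored out; \<open>d\<close> is the gap to the next exponent.\<close>

lemma vvds_normal_form:
  fixes f :: "complex \<Rightarrow> 'a::complex_banach"
  assumes "vvds f"
  obtains l a c d where "dirichlet_series l (a :: nat \<Rightarrow> 'a)" "0 < c" "0 < d" "l 0 = 0" "a 0 \<noteq> 0"
    "\<And>n. 0 < n \<Longrightarrow> d \<le> l n" "\<And>s. f s = exp (s * of_real c) *\<^sub>C dirichlet_series.D l a s"
proof -
  obtain a :: "nat \<Rightarrow> 'a" and l where l: "\<And>n. 1 \<le> n \<Longrightarrow> 0 < l n" "\<And>n. 1 \<le> n \<Longrightarrow> l n < l (Suc n)"
    and lim: "limsup (\<lambda>n. ereal (ln (real n) / l n)) < \<infinity>"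
      "limsup (\<lambda>n. elog (norm (a n)) / ereal (l n)) = -\<infinity>"
    and sums: "\<And>s. (\<lambda>n. exp (s * of_real (l (Suc n))) *\<^sub>C a (Suc n)) sums f s"
    and "f \<noteq> (\<lambda>_. 0)"
    using assms unfolding vvds_def by blast
  have "\<exists>n. a (Suc n) \<noteq> 0"
  proof (rule ccontr)
    assume "\<nexists>n. a (Suc n) \<noteq> 0"
    then have "f s = 0" for s
      using sums[of s] by (simp add: sums_iff)
    with \<open>f \<noteq> (\<lambda>_. 0)\<close> show False by auto
  qed
  then obtain m where m: "a (Suc m) \<noteq> 0" "\<And>i. i < m \<Longrightarrow> a (Suc i) = 0"
    using exists_least_iff[of "\<lambda>n. a (Suc n) \<noteq> 0"] by blast
  define c where "c = l (Suc m)"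
  define l' where "l' n = l (Suc (n + m)) - c" for n
  define a' where "a' n = a (Suc (n + m))" for n
  have "strict_mono (\<lambda>n. l (Suc n))" using l by (simp add: strict_mono_Suc_iff)
  then have mono: "l (Suc i) \<le> l (Suc j)" if "i \<le> j" for i j
    using that monoD[OF strict_mono_mono] by blast
  interpret dirichlet_series l' a'
  proof
    show "0 \<le> l' n" for n using mono[of m "n + m"] by (simp add: l'_def c_def)
    fix x
    \<comment> \<open>The constant \<open>exp (- (x * c))\<close> accounts for lowering all
      exponents by \<open>c\<close>.\<close>
    have "summable (\<lambda>n. exp (- (x * c)) * (norm (a (n + Suc m)) * exp (x * l (n + Suc m))))"
      using vvds_majorant_summable[OF l(1) lim, of x]
      by (intro summable_mult summable_ignore_initial_segment)
    then show "summable (\<lambda>n. norm (a' n) * exp (x * l' n))"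
      by (simp add: l'_def a'_def right_diff_distrib exp_diff exp_minus field_simps)
  qed
  show thesis
  proof
    show "dirichlet_series l' a'" by unfold_locales
    show "0 < c" using l by (simp add: c_def)
    show "0 < l' 1" using l(2)[of "Suc m"] by (simp add: l'_def c_def)
    show "l' 0 = 0" "a' 0 \<noteq> 0" using m by (simp_all add: l'_def c_def a'_def)
    show "l' 1 \<le> l' n" if "0 < n" for n
      using mono[of "1 + m" "n + m"] that by (simp add: l'_def)
    fix s
    have "(\<lambda>n. exp (s * of_real c) *\<^sub>C (exp (s * of_real (l' n)) *\<^sub>C a' n))
        sums (exp (s * of_real c) *\<^sub>C D s)"
      using sums_D by (rule bounded_linear.sums[OF bounded_linear_scaleC_right])
    \<comment> \<open>Dropping the first \<open>m\<close> terms preserves the sum, since their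
      coefficients vanish.\<close>
    moreover have "(\<lambda>n. exp (s * of_real (l (Suc (n + m)))) *\<^sub>C a (Suc (n + m))) sums f s"
      using sums[of s] sums_zero_iff_shift[of m "\<lambda>n. exp (s * of_real (l (Suc n))) *\<^sub>C a (Suc n)" "f s"] m(2)
      by simp
    moreover have "exp (s * of_real c) *\<^sub>C (exp (s * of_real (l' n)) *\<^sub>C a' n)
        = exp (s * of_real (l (Suc (n + m)))) *\<^sub>C a (Suc (n + m))" for n
      by (simp add: scaleC_scaleC l'_def a'_def algebra_simps flip: exp_add)
    ultimately show "f s = exp (s * of_real c) *\<^sub>C D s"
      using sums_unique2 by simp
  qed
qed

lemma vvds_max_modulus_bijective:
  assumes "vvds f"
  shows "strict_mono (max_modulus f)" "range (max_modulus f) = {0<..}"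
proof -
  obtain l a c d where d: "dirichlet_series l a" and c: "0 < c" "0 < d" "l 0 = 0" "a 0 \<noteq> 0"
    "\<And>n. 0 < n \<Longrightarrow> d \<le> l n" and f: "\<And>s. f s = exp (s * of_real c) *\<^sub>C dirichlet_series.D l a s"
    using vvds_normal_form[OF assms] by metis
  interpret dirichlet_series l a by (fact d)
  let ?F = "max_modulus f" and ?S = "max_modulus D"
  have F: "?F = (\<lambda>x. exp (c * x) * ?S x)"
    using max_modulus_exp_mult[OF f] by auto
  have pos: "0 < ?S x" for x using max_modulus_pos c(2-5) by blast
  show "strict_mono ?F"
    unfolding F using c(1) pos max_modulus_mono
    by (intro strict_monoI mult_less_le_imp_less) (auto intro: less_imp_le)
  have cont: "continuous_on UNIV ?F"
    unfolding F by (intro continuous_intros continuous_on_max_modulus)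
  show "range ?F = {0<..}"
  proof (intro equalityI subsetI)
    fix v :: real assume "v \<in> {0<..}"
    then have v: "0 < v" by simp
    \<comment> \<open>The solution of \<open>exp (c * x) * ?S 0 = v\<close>. As \<open>?S\<close> is
      nondecreasing, \<open>v\<close> lies between \<open>?F 0\<close> and \<open>?F x\<close>, in
      an order given by the sign of \<open>x\<close>, and the intermediate value theorem
      applies.\<close>
    define x where "x = ln (v / ?S 0) / c"
    have "exp (c * x) * ?S 0 = v" using v pos[of 0] c(1) by (simp add: x_def)
    have "\<exists>y. ?F y = v"
    proof (cases "0 \<le> x")
      case True
      have "?F 0 \<le> v" using \<open>_ = v\<close> True c(1) pos[of 0] by (auto simp: F)
      moreover have "v \<le> ?F x"
        using max_modulus_mono[OF True] unfolding F \<open>_ = v\<close>[symmetric] by simp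
      ultimately show ?thesis
        using IVT'[of ?F 0 v x] True continuous_on_subset[OF cont] by blast
    next
      case False
      have "v \<le> ?F 0" using \<open>_ = v\<close> False c(1) pos[of 0]
        by (auto simp: F mult_le_cancel_right1 mult_nonneg_nonpos)
      moreover have "?F x \<le> v"
        using max_modulus_mono[of x 0] False unfolding F \<open>_ = v\<close>[symmetric] by simp
      ultimately show ?thesis
        using IVT'[of ?F x v 0] False continuous_on_subset[OF cont] by fastforce
    qed
    then show "v \<in> range ?F" by auto
  qed (use pos in \<open>auto simp: F\<close>)
qed

section \<open>Limits inferior and superior of quotients\<close>

text \<open>Otherwise a constant strictly between the two limits would eventually separate
  \<open>v\<close> from \<open>u\<close>.\<close>

lemma frequently_le_imp_Liminf_le_Limsup:
  fixes u v :: "'a \<Rightarrow> ereal"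
  assumes "\<exists>\<^sub>F x in F. u x \<le> v x"
  shows "Liminf F u \<le> Limsup F v"
proof (rule ccontr)
  assume "\<not> ?thesis"
  then obtain c where c: "Limsup F v < c" "c < Liminf F u"
    using dense[of "Limsup F v" "Liminf F u"] by (auto simp: not_le)
  have "\<forall>\<^sub>F x in F. v x < c" "\<forall>\<^sub>F x in F. c < u x"
    using Limsup_lessD[OF c(1)] less_LiminfD[OF c(2)] .
  then have "\<forall>\<^sub>F x in F. \<not> u x \<le> v x"
    by eventually_elim auto
  with assms show False
    by (simp add: frequently_def)
qed

text \<open>Degenerate denominators: if \<open>b\<close> is infinite, \<open>a\<close> is finite and
  the quotient is 0; if \<open>b = 0\<close>, the inequality forces the excluded
  \<open>0 / 0\<close>.\<close>

lemma meaningful_quotient_le: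
  assumes m: "meaningful_quotient a b" and a: "0 \<le> a" and b: "0 \<le> b" and y: "0 \<le> y"
    and le: "a \<le> ereal y * b"
  shows "a / b \<le> ereal y"
proof -
  consider "b = \<infinity>" | "b = 0" | r where "b = ereal r" "0 < r"
    using b by (cases b) (auto simp: less_le)
  then show ?thesis
  proof cases
    case 1
    with m a y show ?thesis by (cases a) (auto simp: meaningful_quotient_def)
  next
    case 2
    with m a le show ?thesis by (simp add: meaningful_quotient_def flip: zero_ereal_def)
  next
    case 3
    with le show ?thesis by (simp add: ereal_divide_le_pos mult.commute)
  qed
qed

text \<open>If \<open>b\<close> is infinite, \<open>0 < y\<close> makes \<open>a\<close> infinite
  too, which is excluded; if \<open>b = 0\<close>, then \<open>a\<close> is positive and the
  quotient is infinite.\<close>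

lemma le_meaningful_quotient:
  assumes m: "meaningful_quotient a b" and a: "0 \<le> a" and b: "0 \<le> b" and y: "0 < y"
    and le: "ereal y * b \<le> a"
  shows "ereal y \<le> a / b"
proof -
  consider "b = \<infinity>" | "b = 0" | r where "b = ereal r" "0 < r"
    using b by (cases b) (auto simp: less_le)
  then show ?thesis
  proof cases
    case 1
    with m y le show ?thesis by (simp add: meaningful_quotient_def)
  next
    case 2
    with m a show ?thesis by (simp add: meaningful_quotient_def divide_ereal_def less_le)
  next
    case 3
    with le show ?thesis by (simp add: ereal_le_divide_pos mult.commute)
  qed
qed

lemma ereal_divide_nonneg: "0 \<le> a \<Longrightarrow> 0 \<le> b \<Longrightarrow> 0 \<le> a / (b::ereal)"
  by (simp add: divide_ereal_def inverse_ereal_ge0I)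

text \<open>Each inequality is tested against real \<open>y\<close>, where comparing
  \<open>a / b\<close> with \<open>y\<close> means comparing \<open>a\<close> with
  \<open>y * b\<close>. In the two outer inequalities this holds only frequently and links a limit
  inferior to a limit superior; in the four inner ones it holds eventually and passes to limits of
  the same kind.\<close>

lemma Liminf_Limsup_quotient:
  fixes a b :: "'x \<Rightarrow> real"
  assumes F: "F \<noteq> bot"
    and a: "\<forall>\<^sub>F x in F. 0 < a x" and b: "\<forall>\<^sub>F x in F. 0 < b x"
    and la: "la = Liminf F (\<lambda>x. ereal (a x))" and ra: "ra = Limsup F (\<lambda>x. ereal (a x))"
    and lb: "lb = Liminf F (\<lambda>x. ereal (b x))" and rb: "rb = Limsup F (\<lambda>x. ereal (b x))"
    and lc: "lc = Liminf F (\<lambda>x. ereal (a x / b x))" and rc: "rc = Limsup F (\<lambda>x. ereal (a x / b x))"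
    and m: "meaningful_quotient la rb" "meaningful_quotient la lb"
      "meaningful_quotient ra rb" "meaningful_quotient ra lb"
  shows "la / rb \<le> lc" "lc \<le> la / lb" "lc \<le> ra / rb"
    and "la / lb \<le> rc" "ra / rb \<le> rc" "rc \<le> ra / lb"
proof -
  have nonneg: "0 \<le> la" "0 \<le> ra" "0 \<le> lb" "0 \<le> rb"
  proof -
    show "0 \<le> la" "0 \<le> lb"
      unfolding la lb by (intro Liminf_bounded eventually_mono[OF a] eventually_mono[OF b]; simp)+
    then show "0 \<le> ra" "0 \<le> rb"
      unfolding la ra lb rb by (blast intro: order_trans Liminf_le_Limsup[OF F])+
  qed
  have c: "\<forall>\<^sub>F x in F. 0 < a x / b x"
    using a b by eventually_elim auto
  then have lc0: "0 \<le> lc"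
    unfolding lc by (intro Liminf_bounded eventually_mono[OF c]) simp
  then have rc0: "0 \<le> rc"
    unfolding lc rc by (rule order_trans[OF _ Liminf_le_Limsup[OF F]])
  have scale: "Limsup F (\<lambda>x. ereal (y * b x)) = ereal y * rb"
    "Liminf F (\<lambda>x. ereal (y * b x)) = ereal y * lb" if "0 \<le> y" for y
    using that Limsup_ereal_mult_left[OF F, of y "\<lambda>x. ereal (b x)"]
      Liminf_ereal_mult_left[OF F, of y "\<lambda>x. ereal (b x)"] by (simp_all add: rb lb)
  have div_le: "a x / b x \<le> y \<longleftrightarrow> a x \<le> y * b x" "y \<le> a x / b x \<longleftrightarrow> y * b x \<le> a x"
    if "0 < b x" for x y using that by (simp_all add: field_simps)
  \<comment> \<open>Only positive real \<open>y\<close> need testing: smaller values are covered by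
    \<open>0 \<le> t\<close>.\<close>
  have below: "q \<le> t" if "0 \<le> t" "\<And>y. 0 < y \<Longrightarrow> ereal y < q \<Longrightarrow> ereal y \<le> t" for q t
  proof (rule dense_le)
    fix z assume "z < q"
    show "z \<le> t"
    proof (cases "0 < z")
      case True
      with \<open>z < q\<close> that(2) show ?thesis by (cases z) auto
    next
      case False
      with that(1) show ?thesis by (auto simp: not_less intro: order_trans)
    qed
  qed
  have above: "t \<le> q" if "0 \<le> q" "\<And>y. 0 \<le> y \<Longrightarrow> q < ereal y \<Longrightarrow> t \<le> ereal y" for q t
  proof (rule dense_ge)
    fix z assume "q < z"
    then show "t \<le> z"
      using that by (cases z) (auto dest: order_le_less_trans)
  qed
  show "la / rb \<le> lc"
  proof (rule above[OF lc0])
    fix y assume y: "0 \<le> y" "lc < ereal y"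
    have "\<exists>\<^sub>F x in F. a x / b x \<le> y"
    proof (rule ccontr)
      assume "\<not> ?thesis"
      then have "\<forall>\<^sub>F x in F. \<not> a x / b x \<le> y" by (simp only: not_frequently)
      then have "\<forall>\<^sub>F x in F. ereal y \<le> ereal (a x / b x)" by eventually_elim simp
      then have "ereal y \<le> lc" unfolding lc by (rule Liminf_bounded)
      with y show False by simp
    qed
    then have "\<exists>\<^sub>F x in F. ereal (a x) \<le> ereal (y * b x)"
      by (rule frequently_rev_mp) (use b in \<open>eventually_elim, simp add: div_le\<close>)
    then have "la \<le> ereal y * rb"
      unfolding la scale(1)[OF y(1), symmetric] by (rule frequently_le_imp_Liminf_le_Limsup)
    then show "la / rb \<le> ereal y"
      using m nonneg y by (intro meaningful_quotient_le)
  qed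
  show "rc \<le> ra / lb"
  proof (rule below)
    fix y assume y: "0 < y" "ereal y < rc"
    have "\<exists>\<^sub>F x in F. y \<le> a x / b x"
    proof (rule ccontr)
      assume "\<not> ?thesis"
      then have "\<forall>\<^sub>F x in F. \<not> y \<le> a x / b x" by (simp only: not_frequently)
      then have "\<forall>\<^sub>F x in F. ereal (a x / b x) \<le> ereal y" by eventually_elim simp
      then have "rc \<le> ereal y" unfolding rc by (rule Limsup_bounded)
      with y show False by simp
    qed
    then have "\<exists>\<^sub>F x in F. ereal (y * b x) \<le> ereal (a x)"
      by (rule frequently_rev_mp) (use b in \<open>eventually_elim, simp add: div_le\<close>)
    then have "ereal y * lb \<le> ra"
      unfolding ra scale(2)[OF less_imp_le[OF y(1)], symmetric]
      by (rule frequently_le_imp_Liminf_le_Limsup)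
    then show "ereal y \<le> ra / lb"
      using m nonneg y by (intro le_meaningful_quotient)
  qed (intro ereal_divide_nonneg nonneg)
  have lower: "ereal y * lb \<le> la \<and> ereal y * rb \<le> ra" if y: "0 < y" "ereal y < lc" for y
  proof -
    have "\<forall>\<^sub>F x in F. ereal y < ereal (a x / b x)"
      using y unfolding lc by (intro less_LiminfD)
    with b have "\<forall>\<^sub>F x in F. ereal (y * b x) \<le> ereal (a x)"
      by eventually_elim (simp add: less_imp_le flip: div_le)
    then show ?thesis
      unfolding la ra scale[OF less_imp_le[OF y(1)], symmetric]
      by (intro conjI Liminf_mono Limsup_mono)
  qed
  have upper: "la \<le> ereal y * lb \<and> ra \<le> ereal y * rb" if y: "0 \<le> y" "rc < ereal y" for y
  proof -
    have "\<forall>\<^sub>F x in F. ereal (a x / b x) < ereal y"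
      using y unfolding rc by (intro Limsup_lessD)
    with b have "\<forall>\<^sub>F x in F. ereal (a x) \<le> ereal (y * b x)"
      by eventually_elim (simp add: less_imp_le flip: div_le)
    then show ?thesis
      unfolding la ra scale[OF y(1), symmetric] by (intro conjI Liminf_mono Limsup_mono)
  qed
  show "lc \<le> la / lb"
    by (rule below) (use lower in \<open>simp_all add: ereal_divide_nonneg le_meaningful_quotient m nonneg\<close>)
  show "lc \<le> ra / rb"
    by (rule below) (use lower in \<open>simp_all add: ereal_divide_nonneg le_meaningful_quotient m nonneg\<close>)
  show "la / lb \<le> rc"
    by (rule above[OF rc0]) (use upper in \<open>simp add: meaningful_quotient_le m nonneg\<close>)
  show "ra / rb \<le> rc"
    by (rule above[OF rc0]) (use upper in \<open>simp add: meaningful_quotient_le m nonneg\<close>)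
qed

section \<open>Behaviour at infinity and the change of variable\<close>

lemma filterlim_ilog_at_top:
  assumes "0 \<le> k"
  shows "filterlim (ilog k) at_top at_top"
proof -
  have "filterlim ((ln :: real \<Rightarrow> real) ^^ n) at_top at_top" for n
  proof (induction n)
    case 0
    show ?case by (simp add: id_def filterlim_ident)
  next
    case (Suc n)
    show ?case
      using filterlim_compose[OF ln_at_top Suc] by (simp add: o_def)
  qed
  with assms show ?thesis by (simp add: ilog_def)
qed

lemma filterlim_inv_comp_at_top:
  fixes F G :: "real \<Rightarrow> real"
  assumes F: "strict_mono F" and G: "strict_mono G" and range: "range F = range G"
  shows "filterlim (\<lambda>x. inv G (F x)) at_top at_top"
  unfolding filterlim_at_top
proof
  fix Z
  obtain x where x: "F x = G Z" using range by (metis rangeE rangeI)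
  have "Z \<le> inv G (F y)" if "x \<le> y" for y
  proof -
    have "G Z \<le> F y" using monoD[OF strict_mono_mono[OF F] that] x by simp
    also have "F y = G (inv G (F y))" by (metis f_inv_into_f range rangeI)
    finally show ?thesis using G by (simp add: strict_mono_less_eq)
  qed
  then show "\<forall>\<^sub>F y in at_top. Z \<le> inv G (F y)"
    by (rule eventually_at_top_linorderI)
qed

text \<open>The inverse map has the same form with \<open>F\<close> and \<open>G\<close> exchanged,
  so it tends to infinity as well. Equality of the filters is what allows limits in
  \<open>T x\<close> to be read as limits in \<open>x\<close>.\<close>

lemma filtermap_inv_comp_at_top:
  fixes F G :: "real \<Rightarrow> real"
  assumes F: "strict_mono F" and G: "strict_mono G" and range: "range F = range G"
  shows "filtermap (\<lambda>x. inv G (F x)) at_top = at_top"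
proof (rule filtermap_fun_inverse[of "\<lambda>x. inv F (G x)"])
  show "filterlim (\<lambda>x. inv F (G x)) at_top at_top" "filterlim (\<lambda>x. inv G (F x)) at_top at_top"
    using assms by (simp_all add: filterlim_inv_comp_at_top)
  have "inv G (F (inv F (G x))) = x" for x
    using range G by (metis f_inv_into_f inv_f_f rangeI strict_mono_imp_inj_on)
  then show "\<forall>\<^sub>F x in at_top. inv G (F (inv F (G x))) = x" by simp
qed

theorem theorem1:
  fixes f :: "complex \<Rightarrow> 'a::complex_banach"
    and g :: "complex \<Rightarrow> 'b::complex_banach"
    and h :: "complex \<Rightarrow> 'c::complex_banach"
    and k p q m :: int
  assumes "p \<ge> 0" "q \<ge> 0" "m \<ge> 0"
    and "k \<ge> q + 1" "k \<ge> p + 1" "k \<ge> m + 1"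
    and "vvds f" "vvds g" "vvds h"
    and "has_index_pair f k q" "has_index_pair g k p" "has_index_pair h k m"
    and "meaningful_quotient (rel_lower_order m q h f) (rel_order m p h g)"
    and "meaningful_quotient (rel_lower_order m q h f) (rel_lower_order m p h g)"
    and "meaningful_quotient (rel_order m q h f) (rel_order m p h g)"
    and "meaningful_quotient (rel_order m q h f) (rel_lower_order m p h g)"
  shows "rel_lower_order m q h f / rel_order m p h g \<le> rel_lower_order p q g f
    \<and> rel_lower_order p q g f
        \<le> min (rel_lower_order m q h f / rel_lower_order m p h g)
              (rel_order m q h f / rel_order m p h g)
    \<and> min (rel_lower_order m q h f / rel_lower_order m p h g)
          (rel_order m q h f / rel_order m p h g)
        \<le> max (rel_lower_order m q h f / rel_lower_order m p h g)
              (rel_order m q h f / rel_order m p h g)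
    \<and> max (rel_lower_order m q h f / rel_lower_order m p h g)
          (rel_order m q h f / rel_order m p h g)
        \<le> rel_order p q g f
    \<and> rel_order p q g f \<le> rel_order m q h f / rel_lower_order m p h g"
proof -
  let ?F = "max_modulus f" and ?G = "max_modulus g" and ?H = "max_modulus h"
  note F = vvds_max_modulus_bijective[OF \<open>vvds f\<close>]
  note G = vvds_max_modulus_bijective[OF \<open>vvds g\<close>]
  note H = vvds_max_modulus_bijective[OF \<open>vvds h\<close>]
  define T where "T x = inv ?G (?F x)" for x
  have GT: "?G (T x) = ?F x" for x
    unfolding T_def using F(2) G(2) by (metis f_inv_into_f rangeI)
  have "inj T"
    by (rule injI) (metis GT F(1) strict_mono_eq)
  have T: "filtermap T at_top = at_top"
    unfolding T_def using F G by (intro filtermap_inv_comp_at_top) auto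
  define a where "a x = ilog m (inv ?H (?F x)) / ilog q x" for x
  \<comment> \<open>The quotient for \<open>g\<close> is taken at \<open>T x\<close>, where
    \<open>?G (T x) = ?F x\<close> gives it the same numerator as \<open>a x\<close>.\<close>
  define b where "b x = ilog m (inv ?H (?G (T x))) / ilog p (T x)" for x
  have lim_pos: "\<forall>\<^sub>F x in at_top. 0 < ilog n (t x)"
    if "0 \<le> n" "filterlim t at_top at_top" for n :: int and t :: "real \<Rightarrow> real"
    using filterlim_compose[OF filterlim_ilog_at_top that(2)] that(1)
    by (auto simp: filterlim_at_top_dense)
  have pos: "\<forall>\<^sub>F x in at_top. 0 < ilog m (inv ?H (?F x))" "\<forall>\<^sub>F x in at_top. 0 < ilog q x"
    "\<forall>\<^sub>F x in at_top. 0 < ilog p (T x)"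
    using assms(1-3) F G H unfolding T_def
    by (auto intro!: lim_pos filterlim_inv_comp_at_top filterlim_ident)
  have a_pos: "\<forall>\<^sub>F x in at_top. 0 < a x"
    using pos(1,2) by eventually_elim (simp add: a_def)
  have b_pos: "\<forall>\<^sub>F x in at_top. 0 < b x"
    using pos(1,3) by eventually_elim (simp add: b_def GT)
  \<comment> \<open>The common numerator cancels once it is nonzero; zero denominators are harmless
    since division by 0 gives 0.\<close>
  have quot: "\<forall>\<^sub>F x in at_top. ereal (ilog p (inv ?G (?F x)) / ilog q x) = ereal (a x / b x)"
    using pos(1) by eventually_elim (simp add: a_def b_def GT, simp add: T_def)
  have orders_f: "rel_lower_order m q h f = Liminf at_top (\<lambda>x. ereal (a x))"
      "rel_order m q h f = Limsup at_top (\<lambda>x. ereal (a x))"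
    by (simp_all add: rel_lower_order_def rel_order_def a_def)
  \<comment> \<open>Substitution of \<open>T x\<close> for the variable, by injectivity of
    \<open>T\<close> and invariance of the filter.\<close>
  have orders_g: "rel_lower_order m p h g = Liminf at_top (\<lambda>x. ereal (b x))"
      "rel_order m p h g = Limsup at_top (\<lambda>x. ereal (b x))"
    using Liminf_filtermap_eq[OF \<open>inj T\<close>, of at_top] Limsup_filtermap_eq[OF \<open>inj T\<close>, of at_top]
    unfolding T rel_lower_order_def rel_order_def b_def by auto
  have orders_fg: "rel_lower_order p q g f = Liminf at_top (\<lambda>x. ereal (a x / b x))"
      "rel_order p q g f = Limsup at_top (\<lambda>x. ereal (a x / b x))"
    unfolding rel_lower_order_def rel_order_def
    using Liminf_eq[OF quot] Limsup_eq[OF quot] by auto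
  note ineqs = Liminf_Limsup_quotient[OF trivial_limit_at_top_linorder a_pos b_pos orders_f orders_g
      orders_fg assms(13-16)]
  show ?thesis
    using ineqs by (simp add: min_le_iff_disj le_max_iff_disj)
qed

end
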